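(* There exist an absolute constant $C$ and an online (causal) algorithm producing decisions $x_t\in\mathcal K$, using no a priori knowledge of the horizon or of any comparator, such that for every $T\ge1$, every sequence of convex functions $f_1,\dots,f_T:\mathcal K\to\mathbb R$ with subgradients $g_t\in\partial f_t(x_t)$ received at the algorithm's decisions, and simultaneously for every comparator sequence $x_1^*,\dots,x_T^*\in\mathcal K$, $$\sum_{t=1}^T\bigl(f_t(x_t)-f_t(x_t^* )\bigr)\le C\sqrt{\bigl(D_*P_*+D^2\bigr)\sum_{t=1}^T\|g_t\|^2},$$ where $P_*=\sum_{t=1}^{T-1}\|x_{t+1}^*-x_t^*\|$ and $D_*=\max_{1\le t,\tau\le T}\|x_t^*-x_\tau^*\|$.
   Context: $\mathcal K\subset\mathbb R^N$ is a nonempty convex, closed and bounded set with diameter $D=\sup_{x,v\in\mathcal K}\|x-v\|>0$, known to the algorithm; $\|\cdot\|$ is the Euclidean norm. For convex $f:\mathcal K\to\mathbb R$, $\partial f(x)$ is the set of $g\in\mathbb R^N$ with $f(x)-f(v)\le g^\top(x-v)$ for all $v\in\mathcal K$. A causal online algorithm chooses at each round $t$ a decision $x_t\in\mathcal K$ as a function only of $\mathcal K$ and of the subgradients $g_1,\dots,g_{t-1}$ received in earlier rounds; then it receives $g_t\in\partial f_t(x_t)$. *)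

theory Defs
  imports "HOL-Analysis.Analysis"
begin

text \<open>
  The constant of the main theorem is absolute, so the dimension \<open>N\<close> is quantified inside
  the formula and cannot be a type. Points of \<open>\<real>\<^sup>N\<close> are therefore the functions
  \<open>nat \<Rightarrow> real\<close> vanishing from \<open>N\<close> on, i.e. the points of
  \<^term>\<open>Euclidean_space N\<close>, whose (product) topology is the Euclidean one. The norm is
  \<^const>\<open>L2_set\<close> over the first \<open>N\<close> coordinates; the library's metric on
  \<open>nat \<Rightarrow> real\<close> is not the Euclidean one, so \<open>dist\<close>, \<open>bounded\<close>
  and \<open>diameter\<close> must not be used here.
\<close>

type_synonym point = "nat \<Rightarrow> real"

abbreviation Rn :: "nat \<Rightarrow> point set" where
  "Rn N \<equiv> topspace (Euclidean_space N)"

definition enorm :: "nat \<Rightarrow> point \<Rightarrow> real" where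
  "enorm N x = L2_set x {..<N}"

definition dot :: "nat \<Rightarrow> point \<Rightarrow> point \<Rightarrow> real" where
  "dot N x y = (\<Sum>i<N. x i * y i)"

definition cvx_comb :: "real \<Rightarrow> point \<Rightarrow> point \<Rightarrow> point" where
  "cvx_comb a x y = (\<lambda>i. (1 - a) * x i + a * y i)"

definition convex_set :: "point set \<Rightarrow> bool" where
  "convex_set K \<longleftrightarrow> (\<forall>x\<in>K. \<forall>y\<in>K. \<forall>a\<in>{0..1}. cvx_comb a x y \<in> K)"

definition convex_fun_on :: "point set \<Rightarrow> (point \<Rightarrow> real) \<Rightarrow> bool" where
  "convex_fun_on K f \<longleftrightarrow>
     (\<forall>x\<in>K. \<forall>y\<in>K. \<forall>a\<in>{0..1}. f (cvx_comb a x y) \<le> (1 - a) * f x + a * f y)"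

definition bounded_set :: "nat \<Rightarrow> point set \<Rightarrow> bool" where
  "bounded_set N K \<longleftrightarrow> (\<exists>B. \<forall>x\<in>K. enorm N x \<le> B)"

definition diam :: "nat \<Rightarrow> point set \<Rightarrow> real" where
  "diam N K = (SUP (x, v)\<in>K \<times> K. enorm N (x - v))"

definition decision_set :: "nat \<Rightarrow> point set \<Rightarrow> bool" where
  "decision_set N K \<longleftrightarrow>
     closedin (Euclidean_space N) K \<and> K \<noteq> {} \<and> convex_set K \<and> bounded_set N K \<and> diam N K > 0"

definition subdiff :: "nat \<Rightarrow> point set \<Rightarrow> (point \<Rightarrow> real) \<Rightarrow> point \<Rightarrow> point set" where
  "subdiff N K f x = {g \<in> Rn N. \<forall>v\<in>K. f x - f v \<le> dot N g (x - v)}"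

text \<open>
  An online algorithm maps the ambient dimension, the decision set and the chronological list
  of subgradients received so far to the next decision; causality and ignorance of the horizon
  and of the comparators are built into the type.
\<close>

type_synonym online_alg = "nat \<Rightarrow> point set \<Rightarrow> point list \<Rightarrow> point"

definition decision :: "online_alg \<Rightarrow> nat \<Rightarrow> point set \<Rightarrow> (nat \<Rightarrow> point) \<Rightarrow> nat \<Rightarrow> point" where
  "decision A N K g t = A N K (map g [1..<t])"

definition feasible_alg :: "online_alg \<Rightarrow> nat \<Rightarrow> point set \<Rightarrow> bool" where
  "feasible_alg A N K \<longleftrightarrow> (\<forall>gs. set gs \<subseteq> Rn N \<longrightarrow> A N K gs \<in> K)"

definition path_length :: "nat \<Rightarrow> nat \<Rightarrow> (nat \<Rightarrow> point) \<Rightarrow> real" where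
  "path_length N T u = (\<Sum>t=1..T-1. enorm N (u (t+1) - u t))"

definition comparator_diam :: "nat \<Rightarrow> nat \<Rightarrow> (nat \<Rightarrow> point) \<Rightarrow> real" where
  "comparator_diam N T u = Max ((\<lambda>(t, s). enorm N (u t - u s)) ` ({1..T} \<times> {1..T}))"

end

(*
Let y = sum_k w_k b_k, where b_k is projected gradient descent
on the unit ball with step 2^k / sqrt Q, Q being the sum of the past squared gradient norms, and
where w_k in [0,1] is a follow-the-regularised-leader weight with step 2^(-k) / sqrt Q. Against
the weight 0 the k-th summand loses only O(2^(-k) sqrt Q), so it costs nothing to run all k at
once; against the weight 1 it loses O(2^k sqrt Q), no more than the descent with step 2^k / sqrt Q
itself. Choosing k with 4^k close to 1 + P, the regret against a comparator of path length P in
the unit ball is O(sqrt ((1 + P) Q)).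

Write Dc, Pc for the diameter and the path length of the comparators. The decision is the
projection onto K of c + 2 D y, for an arbitrary fixed c in K. The factor Dc Pc (instead of D Pc)
needs no further work: with u_t - c = D v + Dc v_t + (D - Dc) 0, where v = (u_1 - c) / D and
v_t = (u_t - u_1) / Dc, linearity splits the regret into D times a static one, Dc times one of
path length Pc / Dc, and D - Dc times a static one.

The step size must dominate the next gradient, whose size is unknown; so gradients are first
clipped to norm sqrt Q, and what is cut off sums to at most sqrt Q_T because
max 0 (a - sqrt Q) <= sqrt (Q + a^2) - sqrt Q. The projection onto K is made harmless by
removing from the gradient its component along the projection direction whenever that component
would reward leaving K.
*)

theory Submission
  imports Defs
begin

subsection \<open>Euclidean geometry on coordinate functions\<close>

lemma enorm_sqrt: "enorm N x = sqrt (dot N x x)"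
  by (simp add: enorm_def L2_set_def dot_def power2_eq_square)

lemma dot_self_nonneg: "0 \<le> dot N x x"
  by (simp add: dot_def sum_nonneg)

lemma enorm_nonneg: "0 \<le> enorm N x"
  by (simp add: enorm_def)

lemma enorm_power2: "(enorm N x)\<^sup>2 = dot N x x"
  by (simp add: enorm_sqrt dot_self_nonneg)

lemma dot_commute: "dot N x y = dot N y x"
  by (simp add: dot_def mult.commute)

lemma dot_diff_right: "dot N x (y - z) = dot N x y - dot N x z"
  by (simp add: dot_def sum_subtractf algebra_simps)

lemma dot_diff_left: "dot N (x - y) z = dot N x z - dot N y z"
  by (simp add: dot_def sum_subtractf algebra_simps)

lemma dot_scale_left: "dot N (\<lambda>i. c * x i) y = c * dot N x y"
  by (simp add: dot_def sum_distrib_left mult.assoc)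

lemma dot_scale_right: "dot N x (\<lambda>i. c * y i) = c * dot N x y"
  by (metis dot_commute dot_scale_left)

lemmas dot_simps = dot_diff_left dot_diff_right dot_scale_left dot_scale_right

lemma abs_dot_le: "\<bar>dot N x y\<bar> \<le> enorm N x * enorm N y"
proof -
  have "\<bar>dot N x y\<bar> \<le> (\<Sum>i<N. \<bar>x i\<bar> * \<bar>y i\<bar>)"
    unfolding dot_def using sum_abs[of "\<lambda>i. x i * y i" "{..<N}"] by (simp add: abs_mult)
  also have "\<dots> \<le> enorm N x * enorm N y"
    unfolding enorm_def by (rule L2_set_mult_ineq)
  finally show ?thesis .
qed

lemma dot_le: "dot N x y \<le> enorm N x * enorm N y"
  using abs_dot_le[of N x y] by linarith

lemma enorm_triangle_diff: "enorm N (x - z) \<le> enorm N (x - y) + enorm N (y - z)"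
  using L2_set_triangle_ineq[of "x - y" "y - z" "{..<N}"] by (simp add: enorm_def fun_diff_def)

lemma enorm_scale: "enorm N (\<lambda>i. c * x i) = \<bar>c\<bar> * enorm N x"
  by (simp add: enorm_sqrt dot_simps real_sqrt_mult)

lemma enorm_diff_commute: "enorm N (x - y) = enorm N (y - x)"
  by (simp add: enorm_sqrt dot_simps algebra_simps)

lemma enorm_power2_diff_scale:
  "(enorm N (x - (\<lambda>i. c * y i)))\<^sup>2 = (enorm N x)\<^sup>2 - 2 * c * dot N x y + c\<^sup>2 * (enorm N y)\<^sup>2"
  unfolding enorm_power2 dot_simps by (simp add: dot_commute[of N y x] power2_eq_square algebra_simps)

lemma abs_coord_le_enorm: "i < N \<Longrightarrow> \<bar>x i\<bar> \<le> enorm N x"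
  unfolding enorm_def
  using member_le_L2_set[of "{..<N}" i "\<lambda>i. \<bar>x i\<bar>"] by (simp add: L2_set_def)

subsection \<open>One-step learners\<close>

definition ball_proj :: "nat \<Rightarrow> point \<Rightarrow> point" where
  "ball_proj N x = (if enorm N x \<le> 1 then x else (\<lambda>i. (1 / enorm N x) * x i))"

lemma enorm_ball_proj: "enorm N (ball_proj N x) \<le> 1"
  by (cases "enorm N x \<le> 1") (auto simp: ball_proj_def enorm_scale[of N "1 / enorm N x", simplified])

text \<open>Outside the ball, with \<open>n = enorm N x\<close>, the drop in squared distance
  factors as \<open>(n - 1) * (n + 1 - 2 * (dot N x v / n))\<close>, and Cauchy-Schwarz gives
  \<open>dot N x v \<le> n\<close>.\<close>

lemma ball_proj_closer:
  assumes "enorm N v \<le> 1"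
  shows "(enorm N (ball_proj N x - v))\<^sup>2 \<le> (enorm N (x - v))\<^sup>2"
proof (cases "enorm N x \<le> 1")
  case False
  define n where "n = enorm N x"
  have n: "n > 1" using False by (simp add: n_def)
  have nn: "dot N x x = n * n" using enorm_power2[of N x] by (simp add: n_def power2_eq_square)
  have c: "dot N x v \<le> n"
    using dot_le[of N x v] mult_left_mono[OF assms, of n] n unfolding n_def by linarith
  define e where "e = 1 / n"
  have e: "e * n = 1" "n * e = 1" using n by (auto simp: e_def)
  have "ball_proj N x = (\<lambda>i. e * x i)"
    using False by (simp add: ball_proj_def e_def n_def)
  then have "(enorm N (x - v))\<^sup>2 - (enorm N (ball_proj N x - v))\<^sup>2
      = n * n - (e * n) * (e * n) - 2 * dot N x v + 2 * e * dot N x v"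
    by (simp add: enorm_power2 dot_simps dot_commute[of N v x] nn algebra_simps)
  also have "\<dots> = (n - 1) * (n + 1 - 2 * (dot N x v / n))"
    unfolding e using n by (simp add: e_def field_simps)
  also have "\<dots> \<ge> 0"
  proof -
    have "dot N x v / n \<le> 1" using c n by simp
    then show ?thesis using n by (intro mult_nonneg_nonneg) linarith+
  qed
  finally show ?thesis by simp
qed (simp add: ball_proj_def)

text \<open>Controls the stability terms when step sizes see only past gradients. Each term is at
  most three times the increment of \<open>sqrt (Q n)\<close>: if that root at most doubles, the
  increment of \<open>Q\<close> bounds \<open>m n\<close> well enough; if it more than doubles,
  \<open>m n \<le> Q n\<close> suffices.\<close>

lemma sum_le_sqrt:
  fixes m Q :: "nat \<Rightarrow> real"
  assumes "\<And>n. 0 \<le> m n" "\<And>n. m n \<le> Q n" "\<And>n. m n \<le> Q (Suc n) - Q n"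
  shows "(\<Sum>n<T. m n / sqrt (Q n)) \<le> 3 * sqrt (Q T)"
proof (induction T)
  case 0
  show ?case using assms(1,2)[of 0] by simp
next
  case (Suc T)
  have "m T / sqrt (Q T) \<le> 3 * (sqrt (Q (Suc T)) - sqrt (Q T))"
  proof (cases "Q T = 0")
    case False
    define r where "r = sqrt (Q T)"
    define q where "q = sqrt (Q (Suc T))"
    have Q: "Q T > 0" using False assms(1,2)[of T] by linarith
    have r: "r > 0" "r * r = Q T" using Q by (auto simp: r_def)
    have q: "r \<le> q" "q * q = Q (Suc T)"
      using Q assms(1,3)[of T] by (auto simp: r_def q_def)
    have "m T \<le> 3 * (q - r) * r"
    proof (cases "q \<le> 2 * r")
      case True
      have "m T \<le> (q - r) * (q + r)" using assms(3)[of T] q r by (simp add: algebra_simps)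
      also have "\<dots> \<le> (q - r) * (3 * r)" using True q by (intro mult_left_mono) auto
      finally show ?thesis by (simp add: algebra_simps)
    next
      case False
      then have "r * r \<le> 3 * (q - r) * r" using r by (intro mult_right_mono) auto
      then show ?thesis using assms(2)[of T] r by simp
    qed
    then show ?thesis using r by (simp add: r_def[symmetric] q_def[symmetric] divide_le_eq)
  qed (use assms(1,3)[of T] in auto)
  then show ?case using Suc by simp
qed

text \<open>Pays for clipping: since \<open>a n \<le> sqrt (Q (Suc n))\<close>, each excess is at
  most an increment of \<open>sqrt (Q n)\<close>, and these telescope.\<close>

lemma sum_clip_excess_le:
  fixes a Q :: "nat \<Rightarrow> real"
  assumes "\<And>n. 0 \<le> Q n" "\<And>n. Q (Suc n) = Q n + (a n)\<^sup>2"
  shows "(\<Sum>n<T. max 0 (a n - sqrt (Q n))) \<le> sqrt (Q T)"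
proof (induction T)
  case (Suc T)
  have "max 0 (a T - sqrt (Q T)) \<le> sqrt (Q (Suc T)) - sqrt (Q T)"
    using assms(1)[of T] by (auto simp: assms(2) intro!: real_le_rsqrt)
  then show ?case using Suc by (simp del: max.bounded_iff)
qed (simp add: assms)

section \<open>Regret of the scalar weights and of projected gradient descent\<close>

definition clip01 :: "real \<Rightarrow> real" where
  "clip01 x = max 0 (min 1 x)"

text \<open>\<open>w n\<close> minimises the past loss plus \<open>\<beta> n * x\<^sup>2 / 2\<close>
  over \<open>x\<close> in the unit interval. The induction keeps \<open>u\<close> arbitrary because
  its hypothesis is applied to the comparator \<open>w n\<close>; strong convexity then supplies a
  quadratic that absorbs the new loss.\<close>

lemma ftrl_regret:
  fixes z \<beta> w :: "nat \<Rightarrow> real"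
  assumes \<beta>: "\<And>n. 0 \<le> \<beta> n" "\<And>n. \<beta> n \<le> \<beta> (Suc n)"
    and z0: "\<And>n. \<beta> n = 0 \<Longrightarrow> z n = 0"
    and w: "\<And>n. w n = clip01 (- (\<Sum>s<n. z s) / \<beta> n)"
    and u: "0 \<le> u" "u \<le> 1"
  shows "(\<Sum>s<n. z s * w s) \<le> u * (\<Sum>s<n. z s) + \<beta> n * u\<^sup>2 / 2 + (\<Sum>s<n. (z s)\<^sup>2 / (2 * \<beta> s))"
  using u
proof (induction n arbitrary: u)
  case 0
  then show ?case using \<beta>(1)[of 0] by simp
next
  case (Suc n)
  define L where "L = (\<Sum>s<n. z s)"
  have w01: "0 \<le> w n" "w n \<le> 1" by (auto simp: w clip01_def)
  show ?case
  proof (cases "\<beta> n = 0")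
    case True
    have "0 \<le> \<beta> (Suc n) * u\<^sup>2" using \<beta>(1)[of "Suc n"] by simp
    with True Suc.IH[OF Suc.prems] z0[OF True] show ?thesis by simp
  next
    case False
    then have b: "\<beta> n > 0" using \<beta>(1)[of n] by linarith
    \<comment> \<open>First-order optimality of \<open>w n\<close>; the \<open>x\<close> below is
      the unconstrained minimiser.\<close>
    have "0 \<le> (L + \<beta> n * w n) * (u - w n)"
    proof -
      define x where "x = - L / \<beta> n"
      have L: "L = - (\<beta> n * x)" using b by (simp add: x_def)
      have "0 \<le> (w n - x) * (u - w n)"
        using Suc.prems unfolding w[of n] L_def[symmetric] x_def[symmetric] clip01_def
        by (cases "x < 0"; cases "x > 1") (auto simp: mult_nonpos_nonneg intro!: mult_nonpos_nonpos)
      then have "0 \<le> \<beta> n * ((w n - x) * (u - w n))" using b by simp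
      then show ?thesis by (simp add: L algebra_simps)
    qed
    then have 1: "L * w n + \<beta> n * (w n)\<^sup>2 / 2 + \<beta> n * (u - w n)\<^sup>2 / 2 \<le> L * u + \<beta> n * u\<^sup>2 / 2"
      by (simp add: power2_eq_square algebra_simps add_divide_distrib diff_divide_distrib)
    \<comment> \<open>Completing the square trades \<open>z n * (w n - u)\<close> against the
      quadratic gained in \<open>1\<close>.\<close>
    have "0 \<le> (\<beta> n * (u - w n) + z n)\<^sup>2 / (2 * \<beta> n)" using b by simp
    then have 2: "z n * w n \<le> z n * u + \<beta> n * (u - w n)\<^sup>2 / 2 + (z n)\<^sup>2 / (2 * \<beta> n)"
      using b by (simp add: power2_eq_square field_simps)
    have 3: "\<beta> n * u\<^sup>2 / 2 \<le> \<beta> (Suc n) * u\<^sup>2 / 2"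
      using \<beta>(2)[of n] by (simp add: mult_right_mono)
    have 4: "(\<Sum>s<n. z s * w s) \<le> w n * L + \<beta> n * (w n)\<^sup>2 / 2 + (\<Sum>s<n. (z s)\<^sup>2 / (2 * \<beta> s))"
      using Suc.IH[OF w01] by (simp add: L_def)
    show ?thesis using 1 2 3 4 by (simp add: L_def[symmetric] algebra_simps)
  qed
qed

text \<open>The potential is the squared distance to the current comparator, initially at most
  \<open>2\<^sup>2\<close>. Distances in the unit ball are at most 2, so moving the comparator
  raises the potential by at most four times the length of the move.\<close>

lemma ogd_dynamic_regret:
  fixes h b v :: "nat \<Rightarrow> point" and \<beta> :: "nat \<Rightarrow> real"
  assumes \<beta>: "\<And>n. 0 \<le> \<beta> n" "\<And>n. \<beta> n \<le> \<beta> (Suc n)"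
    and h0: "\<And>n. \<beta> n = 0 \<Longrightarrow> enorm N (h n) = 0"
    and b: "\<And>n. b (Suc n) = ball_proj N (b n - (\<lambda>i. (1 / \<beta> n) * h n i))"
    and b0: "enorm N (b 0) \<le> 1"
    and v: "\<And>n. n \<le> T \<Longrightarrow> enorm N (v n) \<le> 1"
  shows "(\<Sum>n<T. dot N (h n) (b n - v n))
    \<le> \<beta> T / 2 * (4 + 4 * (\<Sum>n<T. enorm N (v (Suc n) - v n)))
        + (\<Sum>n<T. (enorm N (h n))\<^sup>2 / (2 * \<beta> n))"
proof -
  note minus_apply [simp del]
  have b1: "enorm N (b n) \<le> 1" for n
    by (cases n) (auto simp: b0 b enorm_ball_proj)
  have near: "enorm N (b n - v m) \<le> 2" if "m \<le> T" for n m
  proof -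
    have "enorm N (b n - v m) \<le> enorm N (b n - (\<lambda>_. 0)) + enorm N ((\<lambda>_. 0) - v m)"
      by (rule enorm_triangle_diff)
    also have "enorm N ((\<lambda>_. 0) - v m) = enorm N (v m - (\<lambda>_. 0))" by (rule enorm_diff_commute)
    finally show ?thesis using b1[of n] v[OF that] by (simp add: fun_diff_def)
  qed
  have step: "dot N (h n) (b n - v n) \<le> \<beta> n / 2 * ((enorm N (b n - v n))\<^sup>2 - (enorm N (b (Suc n) - v n))\<^sup>2)
      + (enorm N (h n))\<^sup>2 / (2 * \<beta> n)" if "n \<le> T" for n
  proof (cases "\<beta> n = 0")
    case True
    then show ?thesis using dot_le[of N "h n" "b n - v n"] h0 by simp
  next
    case False
    then have p: "\<beta> n > 0" using \<beta>(1)[of n] by linarith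
    define e where "e = 1 / \<beta> n"
    have "(enorm N (b (Suc n) - v n))\<^sup>2 \<le> (enorm N ((b n - (\<lambda>i. e * h n i)) - v n))\<^sup>2"
      unfolding b e_def by (rule ball_proj_closer) (rule v[OF that])
    also have "\<dots> = (enorm N ((b n - v n) - (\<lambda>i. e * h n i)))\<^sup>2"
      by (rule arg_cong[where f = "\<lambda>x. (enorm N x)\<^sup>2"]) (auto simp: minus_apply)
    also have "\<dots> = (enorm N (b n - v n))\<^sup>2 - 2 * e * dot N (h n) (b n - v n) + e\<^sup>2 * (enorm N (h n))\<^sup>2"
      unfolding enorm_power2_diff_scale dot_commute[of N "h n"] ..
    finally have "\<beta> n / 2 * (2 * e * dot N (h n) (b n - v n)) \<le> \<beta> n / 2 * ((enorm N (b n - v n))\<^sup>2 - (enorm N (b (Suc n) - v n))\<^sup>2 + e\<^sup>2 * (enorm N (h n))\<^sup>2)"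
      using p by (intro mult_left_mono) auto
    moreover have "\<beta> n / 2 * (2 * e * dot N (h n) (b n - v n)) = dot N (h n) (b n - v n)"
      using p by (simp add: e_def)
    moreover have "\<beta> n / 2 * (e\<^sup>2 * (enorm N (h n))\<^sup>2) = (enorm N (h n))\<^sup>2 / (2 * \<beta> n)"
      using p by (simp add: e_def power2_eq_square)
    ultimately show ?thesis unfolding distrib_left right_diff_distrib by linarith
  qed
  have drift: "(enorm N (b n - v (Suc m)))\<^sup>2 \<le> (enorm N (b n - v m))\<^sup>2 + 4 * enorm N (v (Suc m) - v m)"
    if "Suc m \<le> T" for n m
  proof -
    let ?x = "enorm N (b n - v (Suc m))" and ?y = "enorm N (b n - v m)" and ?p = "enorm N (v (Suc m) - v m)"
    have "?x \<le> ?y + ?p"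
      using enorm_triangle_diff[of N "b n" "v (Suc m)" "v m"] enorm_diff_commute[of N "v m"] by simp
    then have "(?x - ?y) * (?x + ?y) \<le> ?p * (?x + ?y)"
      by (intro mult_right_mono) (auto simp: enorm_nonneg)
    also have "\<dots> \<le> ?p * 4"
      using near[of m n] near[of "Suc m" n] that by (intro mult_left_mono) (auto simp: enorm_nonneg)
    finally show ?thesis by (simp add: power2_eq_square algebra_simps)
  qed
  \<comment> \<open>Keeping the negative potential strengthens the induction. The bracket stays
    nonnegative after each descent step, so the factor \<open>\<beta> m\<close> in front of it may
    grow to \<open>\<beta> (Suc m)\<close>.\<close>
  have "(\<Sum>n<m. dot N (h n) (b n - v n))
    \<le> \<beta> m / 2 * (4 + 4 * (\<Sum>n<m. enorm N (v (Suc n) - v n)) - (enorm N (b m - v m))\<^sup>2)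
        + (\<Sum>n<m. (enorm N (h n))\<^sup>2 / (2 * \<beta> n))" if "m \<le> T" for m
    using that
  proof (induction m)
    case 0
    have "(enorm N (b 0 - v 0))\<^sup>2 \<le> 2\<^sup>2" using near[of 0 0] by (intro power_mono) (auto simp: enorm_nonneg)
    then have "0 \<le> \<beta> 0 / 2 * (4 - (enorm N (b 0 - v 0))\<^sup>2)"
      using \<beta>(1)[of 0] by (intro mult_nonneg_nonneg) auto
    then show ?case by simp
  next
    case (Suc m)
    define S where "S = 4 + 4 * (\<Sum>n<m. enorm N (v (Suc n) - v n))"
    have S: "4 \<le> S" by (simp add: S_def sum_nonneg enorm_nonneg)
    define d where "d = (enorm N (b (Suc m) - v m))\<^sup>2"
    have d: "d \<le> 4"
      unfolding d_def using power_mono[OF near[of m "Suc m"], of 2] Suc.prems by (simp add: enorm_nonneg)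
    have "(\<Sum>n<Suc m. dot N (h n) (b n - v n)) \<le> \<beta> m / 2 * (S - d) + (\<Sum>n<Suc m. (enorm N (h n))\<^sup>2 / (2 * \<beta> n))"
      using Suc step[of m] by (simp add: S_def d_def algebra_simps)
    moreover have "\<beta> m / 2 * (S - d) \<le> \<beta> (Suc m) / 2 * (S - d)"
      using \<beta>(2)[of m] S d by (intro mult_right_mono) auto
    moreover have "\<beta> (Suc m) / 2 * (S - d) \<le> \<beta> (Suc m) / 2 * (S + 4 * enorm N (v (Suc m) - v m) - (enorm N (b (Suc m) - v (Suc m)))\<^sup>2)"
      using \<beta>(1)[of "Suc m"] drift[of m "Suc m"] Suc.prems by (intro mult_left_mono) (auto simp: d_def)
    ultimately show ?case by (simp add: S_def algebra_simps)
  qed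
  from this[of T] have "(\<Sum>n<T. dot N (h n) (b n - v n))
    \<le> \<beta> T / 2 * (4 + 4 * (\<Sum>n<T. enorm N (v (Suc n) - v n)) - (enorm N (b T - v T))\<^sup>2)
        + (\<Sum>n<T. (enorm N (h n))\<^sup>2 / (2 * \<beta> n))" by simp
  moreover have "\<beta> T / 2 * (4 + 4 * (\<Sum>n<T. enorm N (v (Suc n) - v n)) - (enorm N (b T - v T))\<^sup>2) \<le> \<beta> T / 2 * (4 + 4 * (\<Sum>n<T. enorm N (v (Suc n) - v n)))"
    using \<beta>(1)[of T] by (intro mult_left_mono) auto
  ultimately show ?thesis by linarith
qed

subsection \<open>The combined learner on the unit ball\<close>

text \<open>Abstracts from how gradients and decisions depend on each other. The bounds
  \<open>h_le\<close> are those of \<open>sum_le_sqrt\<close>; the second is only an inequality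
  because \<open>Q\<close> will count gradients before clipping. At scale \<open>k\<close> the
  descent has \<open>\<beta> n = sqrt (Q n) / 2 ^ k\<close>, its weight
  \<open>\<beta> n = 2 ^ k * sqrt (Q n)\<close>.\<close>

locale universal_learner =
  fixes N :: nat and h :: "nat \<Rightarrow> point" and Q :: "nat \<Rightarrow> real"
    and b :: "nat \<Rightarrow> nat \<Rightarrow> point" and w :: "nat \<Rightarrow> nat \<Rightarrow> real"
  assumes h_le: "(enorm N (h n))\<^sup>2 \<le> Q n" "(enorm N (h n))\<^sup>2 \<le> Q (Suc n) - Q n"
    and b_0: "b k 0 = (\<lambda>_. 0)"
    and b_Suc: "b k (Suc n) = ball_proj N (b k n - (\<lambda>i. (1 / (sqrt (Q n) / 2 ^ k)) * h n i))"
    and w_eq: "w k n = clip01 (- (\<Sum>s<n. dot N (h s) (b k s)) / (2 ^ k * sqrt (Q n)))"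
begin

definition y :: "nat \<Rightarrow> point" where
  "y n = (\<lambda>i. \<Sum>k. w k n * b k n i)"

lemma Q_nonneg: "0 \<le> Q n"
  using h_le(1)[of n] zero_le_power2[of "enorm N (h n)"] by linarith

lemma Q_mono: "Q n \<le> Q (Suc n)"
  using h_le(2)[of n] zero_le_power2[of "enorm N (h n)"] by linarith

lemma h_eq_0: "Q n = 0 \<Longrightarrow> enorm N (h n) = 0"
  using h_le(1)[of n] by simp

lemma error_le: "(\<Sum>n<T. (enorm N (h n))\<^sup>2 / sqrt (Q n)) \<le> 3 * sqrt (Q T)"
  by (rule sum_le_sqrt) (auto simp: h_le)

lemma enorm_b: "enorm N (b k n) \<le> 1"
proof (cases n)
  case 0
  then show ?thesis by (simp add: b_0 enorm_def L2_set_def)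
qed (simp only: b_Suc enorm_ball_proj)

lemma abs_b_le: "i < N \<Longrightarrow> \<bar>b k n i\<bar> \<le> 1"
  using abs_coord_le_enorm[of i N "b k n"] enorm_b[of k n] by linarith

lemma abs_dot_h_b: "\<bar>dot N (h n) (b k n)\<bar> \<le> enorm N (h n)"
  using abs_dot_le[of N "h n" "b k n"] mult_left_mono[OF enorm_b enorm_nonneg, of N "h n" k n]
  by simp

lemma dot_h_b_eq_0: "Q n = 0 \<Longrightarrow> dot N (h n) (b k n) = 0"
  using abs_dot_h_b[of n k] h_eq_0[of n] by simp

text \<open>The regulariser grows like \<open>2 ^ k\<close>, so the weights decay geometrically in
  \<open>k\<close>. This makes the series defining \<open>y\<close> converge, with no bound on the
  scale known in advance.\<close>

lemma abs_w_le: "\<bar>w k n\<bar> \<le> (\<Sum>s<n. enorm N (h s)) / sqrt (Q n) * (1 / 2) ^ k"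
proof -
  have "\<bar>w k n\<bar> \<le> \<bar>(\<Sum>s<n. dot N (h s) (b k s)) / (2 ^ k * sqrt (Q n))\<bar>"
  proof -
    have "\<bar>clip01 (- x)\<bar> \<le> \<bar>x\<bar>" for x by (auto simp: clip01_def)
    then show ?thesis unfolding w_eq minus_divide_left[symmetric] .
  qed
  also have "\<dots> \<le> (\<Sum>s<n. enorm N (h s)) / (2 ^ k * sqrt (Q n))"
  proof -
    have "\<bar>\<Sum>s<n. dot N (h s) (b k s)\<bar> \<le> (\<Sum>s<n. enorm N (h s))"
      by (rule order_trans[OF sum_abs]) (intro sum_mono abs_dot_h_b)
    then show ?thesis
      by (simp add: abs_divide abs_mult Q_nonneg divide_right_mono)
  qed
  finally show ?thesis by (simp add: power_divide mult.commute)
qed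

lemma summable_w: "summable (\<lambda>k. w k n * c k)" if "\<And>k. \<bar>c k\<bar> \<le> B" for c B
proof (rule summable_comparison_test'[where N = 0])
  define M where "M = (\<Sum>s<n. enorm N (h s)) / sqrt (Q n)"
  show "summable (\<lambda>k. M * (1 / 2) ^ k * B)"
    by (intro summable_mult summable_mult2 summable_geometric) simp
  show "norm (w k n * c k) \<le> M * (1 / 2) ^ k * B" for k
    unfolding real_norm_def abs_mult M_def
    by (intro mult_mono abs_w_le that mult_nonneg_nonneg divide_nonneg_nonneg sum_nonneg)
       (auto simp: enorm_nonneg Q_nonneg)
qed

lemma dot_h_y: "dot N (h n) (y n) = (\<Sum>k. w k n * dot N (h n) (b k n))"
proof -
  have "dot N (h n) (y n) = (\<Sum>i<N. \<Sum>k. h n i * (w k n * b k n i))"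
    unfolding dot_def y_def
    by (intro sum.cong refl suminf_mult[symmetric] summable_w[of _ 1])
       (auto intro: abs_b_le)
  also have "\<dots> = (\<Sum>k. \<Sum>i<N. h n i * (w k n * b k n i))"
    by (intro suminf_sum[symmetric] summable_mult summable_w[of _ 1])
       (auto intro: abs_b_le)
  also have "\<dots> = (\<Sum>k. w k n * dot N (h n) (b k n))"
    by (simp add: dot_def sum_distrib_left mult_ac)
  finally show ?thesis .
qed

text \<open>Applied at two values: \<open>u = 0\<close> leaves only a term summable over
  \<open>k\<close>, and \<open>u = 1\<close> compares with the full descent at scale
  \<open>k\<close>.\<close>

lemma weight_regret:
  assumes "0 \<le> u" "u \<le> 1"
  shows "(\<Sum>n<T. w k n * dot N (h n) (b k n))
    \<le> u * (\<Sum>n<T. dot N (h n) (b k n)) + 2 ^ k * u\<^sup>2 / 2 * sqrt (Q T) + 3 / 2 * (1 / 2) ^ k * sqrt (Q T)"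
proof -
  have "(\<Sum>n<T. dot N (h n) (b k n) * w k n)
    \<le> u * (\<Sum>n<T. dot N (h n) (b k n)) + (2 ^ k * sqrt (Q T)) * u\<^sup>2 / 2
      + (\<Sum>n<T. (dot N (h n) (b k n))\<^sup>2 / (2 * (2 ^ k * sqrt (Q n))))"
    by (rule ftrl_regret)
       (auto simp: Q_nonneg Q_mono w_eq assms dot_h_b_eq_0)
  also have "(\<Sum>n<T. (dot N (h n) (b k n))\<^sup>2 / (2 * (2 ^ k * sqrt (Q n))))
      \<le> (\<Sum>n<T. (enorm N (h n))\<^sup>2 / (2 * (2 ^ k * sqrt (Q n))))"
    by (intro sum_mono divide_right_mono)
       (auto simp: Q_nonneg enorm_nonneg abs_dot_h_b intro!: power2_le_iff_abs_le[THEN iffD2])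
  also have "\<dots> = (1 / 2) * (1 / 2) ^ k * (\<Sum>n<T. (enorm N (h n))\<^sup>2 / sqrt (Q n))"
    unfolding sum_distrib_left by (intro sum.cong) (auto simp: power_divide field_simps)
  also have "\<dots> \<le> (1 / 2) * (1 / 2) ^ k * (3 * sqrt (Q T))"
    by (intro mult_left_mono error_le) auto
  finally show ?thesis by (simp add: mult.commute algebra_simps)
qed

lemma expert_regret:
  assumes "\<And>n. n \<le> T \<Longrightarrow> enorm N (v n) \<le> 1"
  defines "P \<equiv> \<Sum>n<T. enorm N (v (Suc n) - v n)"
  shows "(\<Sum>n<T. dot N (h n) (b k n)) \<le> (\<Sum>n<T. dot N (h n) (v n))
    + (2 * (1 + P) / 2 ^ k + 3 / 2 * 2 ^ k) * sqrt (Q T)"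
proof -
  have regret: "(\<Sum>n<T. dot N (h n) (b k n - v n)) \<le> (sqrt (Q T) / 2 ^ k) / 2 * (4 + 4 * P)
        + (\<Sum>n<T. (enorm N (h n))\<^sup>2 / (2 * (sqrt (Q n) / 2 ^ k)))"
    unfolding P_def
    by (rule ogd_dynamic_regret)
       (auto simp: Q_nonneg Q_mono b_Suc h_eq_0 assms enorm_b divide_right_mono)
  have "(\<Sum>n<T. (enorm N (h n))\<^sup>2 / (2 * (sqrt (Q n) / 2 ^ k)))
      = 2 ^ k / 2 * (\<Sum>n<T. (enorm N (h n))\<^sup>2 / sqrt (Q n))"
    unfolding sum_distrib_left by (intro sum.cong) (auto simp: field_simps)
  also have "\<dots> \<le> 2 ^ k / 2 * (3 * sqrt (Q T))"
    by (intro mult_left_mono error_le) auto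
  finally have "sqrt (Q T) / 2 ^ k / 2 * (4 + 4 * P)
        + (\<Sum>n<T. (enorm N (h n))\<^sup>2 / (2 * (sqrt (Q n) / 2 ^ k)))
      \<le> (2 * (1 + P) / 2 ^ k + 3 / 2 * 2 ^ k) * sqrt (Q T)"
    by (simp add: field_simps)
  with regret show ?thesis by (simp add: dot_diff_right sum_subtractf)
qed

theorem dynamic_regret:
  assumes v: "\<And>n. n \<le> T \<Longrightarrow> enorm N (v n) \<le> 1"
  defines "P \<equiv> \<Sum>n<T. enorm N (v (Suc n) - v n)"
  shows "(\<Sum>n<T. dot N (h n) (y n - v n)) \<le> 9 * sqrt ((1 + P) * Q T)"
proof -
  define s where "s = sqrt (1 + P)"
  define R where "R = sqrt (Q T)"
  have P: "0 \<le> P" by (simp add: P_def sum_nonneg enorm_nonneg)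
  then have s: "1 \<le> s" "s * s = 1 + P" by (auto simp: s_def)
  have R: "0 \<le> R" by (simp add: R_def Q_nonneg)
  \<comment> \<open>The scale \<open>j = m - 1\<close> satisfies
    \<open>2 ^ j \<le> s < 2 ^ Suc j\<close>, where the two terms of \<open>expert_regret\<close>
    balance.\<close>
  define m where "m = (LEAST m. s < 2 ^ m)"
  have m: "s < 2 ^ m"
    unfolding m_def using real_arch_pow[of 2 s] by (auto intro: LeastI)
  have "m \<noteq> 0" using m s by (cases m) auto
  then obtain j where j: "m = Suc j" by (cases m) auto
  have j2: "2 ^ j \<le> s" using not_less_Least[where k = j and P = "\<lambda>m. s < 2 ^ m"] j by (simp add: m_def)
  define V where "V = (\<Sum>n<T. dot N (h n) (v n))"
  define a where "a k = (\<Sum>n<T. w k n * dot N (h n) (b k n))" for k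
  have a: "a k \<le> 3 / 2 * R * (1 / 2) ^ k" for k
    using weight_regret[of 0 k T] by (simp add: a_def R_def mult_ac)
  \<comment> \<open>Scale \<open>j\<close> alone is compared with weight 1; all others use the bound
    \<open>a\<close> from weight 0.\<close>
  have "a j \<le> (\<Sum>n<T. dot N (h n) (b j n)) + 2 ^ j / 2 * R + 3 / 2 * (1 / 2) ^ j * R"
    using weight_regret[of 1 j T] by (simp add: a_def R_def)
  also have "(\<Sum>n<T. dot N (h n) (b j n)) \<le> V + (2 * (1 + P) / 2 ^ j + 3 / 2 * 2 ^ j) * R"
    using expert_regret[where T = T and v = v and k = j, OF v] by (simp add: V_def P_def R_def)
  finally have "a j \<le> V + (2 * (1 + P) / 2 ^ j + 2 * 2 ^ j) * R + 3 / 2 * R * (1 / 2) ^ j"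
    by (simp add: algebra_simps)
  also have "(2 * (1 + P) / 2 ^ j + 2 * 2 ^ j) * R \<le> (6 * s) * R"
  proof (intro mult_right_mono R)
    have "s * s \<le> (2 * 2 ^ j) * s" using m s by (intro mult_right_mono) (auto simp: j)
    then have "(1 + P) / 2 ^ j \<le> 2 * s" by (simp add: s(2) field_simps)
    then have "2 * (1 + P) / 2 ^ j \<le> 4 * s" unfolding times_divide_eq_right[symmetric] by linarith
    then show "2 * (1 + P) / 2 ^ j + 2 * 2 ^ j \<le> 6 * s" using j2 by linarith
  qed
  finally have aj: "a j \<le> 3 / 2 * R * (1 / 2) ^ j + (V + 6 * s * R)" by simp
  have summ: "summable (\<lambda>k. w k n * dot N (h n) (b k n))" for n
    by (rule summable_w) (rule abs_dot_h_b)
  have "(\<Sum>n<T. dot N (h n) (y n)) = suminf a"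
    unfolding dot_h_y a_def by (intro suminf_sum[symmetric] summ)
  \<comment> \<open>The geometric terms sum to \<open>3 * R\<close>, and \<open>V\<close> enters
    once, through scale \<open>j\<close>.\<close>
  also have "\<dots> \<le> 3 * R + (V + 6 * s * R)"
  proof (rule sums_le)
    have "(\<lambda>k. 3 / 2 * R * (1 / 2) ^ k) sums (3 / 2 * R * (1 / (1 - 1 / 2)))"
      by (intro sums_mult geometric_sums) simp
    from sums_add[OF this sums_single[where i = j and f = "\<lambda>_. V + 6 * s * R"]]
    show "(\<lambda>k. 3 / 2 * R * (1 / 2) ^ k + (if k = j then V + 6 * s * R else 0)) sums (3 * R + (V + 6 * s * R))"
      by simp
    show "a k \<le> 3 / 2 * R * (1 / 2) ^ k + (if k = j then V + 6 * s * R else 0)" for k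
      using a aj by simp
    show "a sums suminf a"
      unfolding a_def by (intro summable_sums summable_sum summ)
  qed
  also have "3 * R + (V + 6 * s * R) \<le> V + 9 * (s * R)"
    using mult_right_mono[OF s(1) R] by (simp add: mult_ac)
  finally show ?thesis
    by (simp add: dot_diff_right sum_subtractf V_def s_def R_def real_sqrt_mult)
qed

end

subsection \<open>Restriction to the decision set\<close>

text \<open>Coordinates from \<open>N\<close> on vanish and the others are bounded by the norm, so
  \<open>K\<close> is a closed subset of a product of compact intervals, hence compact by
  Tychonoff.\<close>

lemma nearest_point_exists:
  assumes "decision_set N K"
  shows "\<exists>x\<in>K. \<forall>v\<in>K. enorm N (p - x) \<le> enorm N (p - v)"
proof -
  have K: "closed K" "K \<subseteq> Rn N" "K \<noteq> {}"
    using assms by (auto simp: decision_set_def closedin_Euclidean_space_iff)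
  obtain B where B: "\<And>x. x \<in> K \<Longrightarrow> enorm N x \<le> B"
    using assms by (auto simp: decision_set_def bounded_set_def)
  have "K \<subseteq> (\<Pi>\<^sub>E i\<in>UNIV. {-\<bar>B\<bar>..\<bar>B\<bar>})"
  proof
    fix x assume x: "x \<in> K"
    have "\<bar>x i\<bar> \<le> \<bar>B\<bar>" for i
    proof (cases "i < N")
      case True
      then show ?thesis using abs_coord_le_enorm[of i N x] B[OF x] by linarith
    next
      case False
      then show ?thesis using K(2) x by (auto simp: topspace_Euclidean_space)
    qed
    then show "x \<in> (\<Pi>\<^sub>E i\<in>UNIV. {-\<bar>B\<bar>..\<bar>B\<bar>})" by (auto simp: abs_le_iff minus_le_iff)
  qed
  moreover have "compact (\<Pi>\<^sub>E i\<in>UNIV. {-\<bar>B\<bar>..\<bar>B\<bar>} :: (nat \<Rightarrow> real) set)"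
    by (simp add: euclidean_product_topology[symmetric] compactin_PiE flip: compactin_euclidean_iff)
       (simp add: compactin_euclidean_iff)
  ultimately have "compact K"
    using K(1) by (metis compact_Int_closed inf.absorb_iff2)
  moreover have "continuous_on K (\<lambda>x. enorm N (p - x))"
    unfolding enorm_def L2_set_def minus_apply
    by (intro continuous_intros continuous_on_subset[OF continuous_on_product_coordinates]) auto
  ultimately show ?thesis using continuous_attains_inf K(3) by blast
qed

definition nearest :: "nat \<Rightarrow> point set \<Rightarrow> point \<Rightarrow> point" where
  "nearest N K p = (SOME x. x \<in> K \<and> (\<forall>v\<in>K. enorm N (p - x) \<le> enorm N (p - v)))"

lemma nearest:
  assumes "decision_set N K"
  shows nearest_in: "nearest N K p \<in> K"
    and nearest_le: "v \<in> K \<Longrightarrow> enorm N (p - nearest N K p) \<le> enorm N (p - v)"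
proof -
  have "nearest N K p \<in> K \<and> (\<forall>v\<in>K. enorm N (p - nearest N K p) \<le> enorm N (p - v))"
    unfolding nearest_def
    using someI_ex[OF nearest_point_exists[OF assms, of p, unfolded Bex_def]] .
  then show "nearest N K p \<in> K" "v \<in> K \<Longrightarrow> enorm N (p - nearest N K p) \<le> enorm N (p - v)"
    by auto
qed

lemma nearest_variational:
  assumes "decision_set N K" "v \<in> K"
  shows "dot N (p - nearest N K p) (v - nearest N K p) \<le> 0"
proof (rule ccontr)
  define x where "x = nearest N K p"
  define d where "d = dot N (p - x) (v - x)"
  define m where "m = (enorm N (v - x))\<^sup>2"
  assume "\<not> ?thesis"
  then have d: "d > 0" by (simp add: d_def x_def)
  have m: "m \<ge> 0" by (simp add: m_def)
  \<comment> \<open>A step towards \<open>v\<close> short enough that its quadratic cost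
    \<open>a * m\<close> is at most \<open>d\<close>, so that it would come closer to
    \<open>p\<close>. The denominator is positive even for \<open>m = 0\<close>.\<close>
  define a where "a = d / (m + d)"
  have a: "0 < a" "a \<le> 1" "a * m \<le> d"
    using d m by (auto simp: a_def field_simps add_pos_nonneg add_nonneg_pos)
  have "cvx_comb a x v \<in> K"
    using assms a nearest_in[OF assms(1), of p] by (auto simp: decision_set_def convex_set_def x_def)
  from nearest_le[OF assms(1) this, of p]
  have "(enorm N (p - x))\<^sup>2 \<le> (enorm N (p - cvx_comb a x v))\<^sup>2"
    by (intro power_mono) (auto simp: x_def enorm_nonneg)
  moreover have "p - cvx_comb a x v = (p - x) - (\<lambda>i. a * (v - x) i)"
    by (auto simp: cvx_comb_def algebra_simps)
  ultimately have "a * (2 * d) \<le> a * (a * m)"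
    using enorm_power2_diff_scale[of N "p - x" a "v - x"]
    by (simp add: d_def m_def power2_eq_square mult_ac del: minus_apply)
  then have "2 * d \<le> a * m" using a by simp
  then show False using a d by simp
qed

section \<open>Surrogate and clipped gradients\<close>

definition surrogate :: "nat \<Rightarrow> point set \<Rightarrow> point \<Rightarrow> point \<Rightarrow> point" where
  "surrogate N K p g = (let d = p - nearest N K p in
     if 0 \<le> dot N g d then g else g - (\<lambda>i. dot N g d / (enorm N d)\<^sup>2 * d i))"

text \<open>With \<open>x\<close> the nearest point and \<open>d = p - x\<close>, the surrogate has
  nonnegative inner product with \<open>d\<close>, so passing from \<open>x\<close> to
  \<open>p\<close> only adds loss. Subtracting a nonpositive multiple of \<open>d\<close> cannot
  lower the right side, by \<open>nearest_variational\<close>.\<close>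

lemma surrogate_regret:
  assumes "decision_set N K" "u \<in> K"
  shows "dot N g (nearest N K p - u) \<le> dot N (surrogate N K p g) (p - u)"
proof -
  define x where "x = nearest N K p"
  define d where "d = p - x"
  have pu: "p - u = d - (u - x)" by (auto simp: d_def)
  have var: "dot N d (u - x) \<le> 0"
    using nearest_variational[OF assms, of p] by (simp add: d_def x_def)
  have neg: "dot N y (x - u) = - dot N y (u - x)" for y
    by (simp add: dot_diff_right)
  show ?thesis
  proof (cases "0 \<le> dot N g d")
    case True
    then show ?thesis
      by (simp add: surrogate_def Let_def x_def[symmetric] d_def[symmetric] pu dot_diff_right[of N _ d] neg)
  next
    case False
    define c where "c = dot N g d / (enorm N d)\<^sup>2"
    have "c \<le> 0" using False by (simp add: c_def divide_nonpos_nonneg)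
    then have c: "0 \<le> c * dot N d (u - x)" using var by (rule mult_nonpos_nonpos)
    have "(enorm N d)\<^sup>2 \<noteq> 0" using False abs_dot_le[of N g d] by auto
    then have e: "c * dot N d d = dot N g d" by (simp add: c_def enorm_power2)
    have s: "surrogate N K p g = g - (\<lambda>i. c * d i)"
      using False by (simp add: surrogate_def Let_def x_def[symmetric] d_def[symmetric] c_def)
    show ?thesis
      unfolding s x_def[symmetric] pu dot_diff_right[of N _ d] dot_diff_left[of N g] dot_scale_left e neg
      using c by simp
  qed
qed

text \<open>Pythagoras: a negative component along \<open>d\<close> is projected away. If
  \<open>enorm N d = 0\<close>, the coefficient is \<open>0\<close> by the convention on
  division.\<close>

lemma enorm_surrogate_le: "enorm N (surrogate N K p g) \<le> enorm N g"
proof -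
  define d where "d = p - nearest N K p"
  define c where "c = dot N g d / (enorm N d)\<^sup>2"
  have "dot N g d = 0" if "enorm N d = 0"
    using abs_dot_le[of N g d] that by simp
  then have "(enorm N (g - (\<lambda>i. c * d i)))\<^sup>2 = (enorm N g)\<^sup>2 - (dot N g d)\<^sup>2 / (enorm N d)\<^sup>2"
    unfolding enorm_power2_diff_scale c_def
    by (cases "enorm N d = 0") (auto simp: power2_eq_square)
  also have "\<dots> \<le> (enorm N g)\<^sup>2" by simp
  finally have "enorm N (g - (\<lambda>i. c * d i)) \<le> enorm N g"
    by (rule power2_le_imp_le) (rule enorm_nonneg)
  then show ?thesis
    by (simp add: surrogate_def Let_def c_def d_def)
qed

definition clip_norm :: "nat \<Rightarrow> real \<Rightarrow> point \<Rightarrow> point" where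
  "clip_norm N r g = (if enorm N g \<le> r then g else (\<lambda>i. r / enorm N g * g i))"

lemma enorm_clip_norm_le:
  assumes "0 \<le> r"
  shows "enorm N (clip_norm N r g) \<le> r" "enorm N (clip_norm N r g) \<le> enorm N g"
proof -
  have e: "enorm N (\<lambda>i. r / enorm N g * g i) = r" if "\<not> enorm N g \<le> r"
    unfolding enorm_scale using that assms by auto
  show "enorm N (clip_norm N r g) \<le> r" "enorm N (clip_norm N r g) \<le> enorm N g"
    unfolding clip_norm_def using e by auto
qed

lemma enorm_diff_clip_norm:
  assumes "0 \<le> r"
  shows "enorm N (g - clip_norm N r g) = max 0 (enorm N g - r)"
proof (cases "enorm N g \<le> r")
  case True
  then show ?thesis by (simp add: clip_norm_def enorm_def L2_set_def)
next
  case False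
  then have "g - clip_norm N r g = (\<lambda>i. (1 - r / enorm N g) * g i)"
    by (auto simp: clip_norm_def algebra_simps)
  then have "enorm N (g - clip_norm N r g) = \<bar>1 - r / enorm N g\<bar> * enorm N g"
    by (simp only: enorm_scale)
  also have "\<dots> = max 0 (enorm N g - r)"
    using False assms by (auto simp: abs_if field_simps)
  finally show ?thesis .
qed

lemma enorm_diff_le_diam:
  assumes "decision_set N K" "x \<in> K" "v \<in> K"
  shows "enorm N (x - v) \<le> diam N K"
proof -
  obtain B where B: "\<And>x. x \<in> K \<Longrightarrow> enorm N x \<le> B"
    using assms by (auto simp: decision_set_def bounded_set_def)
  have "enorm N (a - c) \<le> B + B" if "a \<in> K" "c \<in> K" for a c
    using enorm_triangle_diff[of N a c "\<lambda>_. 0"] enorm_diff_commute[of N c "\<lambda>_. 0"] B[OF that(1)] B[OF that(2)]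
    by (simp add: fun_diff_def)
  then have "bdd_above ((\<lambda>(x, v). enorm N (x - v)) ` (K \<times> K))"
    by (auto intro!: bdd_aboveI[of _ "B + B"])
  from cSUP_upper[OF _ this, of "(x, v)"] show ?thesis
    using assms by (simp add: diam_def)
qed

subsection \<open>The algorithm\<close>

text \<open>
  A state holds the sum of the squared gradient norms, the iterates of gradient descent for every
  \<open>k\<close>, and the cumulative losses driving the weights. While that sum is \<open>0\<close>,
  all step sizes are divisions by zero, harmlessly: the feedback is then clipped to \<open>0\<close>.
\<close>

type_synonym state = "real \<times> (nat \<Rightarrow> point) \<times> (nat \<Rightarrow> real)"

fun unprojected :: "nat \<Rightarrow> point set \<Rightarrow> state \<Rightarrow> point" where
  "unprojected N K (q, b, L) = (\<lambda>i. (SOME x. x \<in> K) i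
     + 2 * diam N K * (\<Sum>k. clip01 (- L k / (2 ^ k * sqrt q)) * b k i))"

text \<open>Clipping precedes the surrogate, which cannot lengthen its argument, so the norm bounds
  from clipping survive.\<close>

definition feedback :: "nat \<Rightarrow> point set \<Rightarrow> state \<Rightarrow> point \<Rightarrow> point" where
  "feedback N K S g = surrogate N K (unprojected N K S) (clip_norm N (sqrt (fst S)) g)"

text \<open>The unclipped norm enters \<open>q\<close>, so a large gradient raises the clipping
  level of later rounds, as \<open>sum_clip_excess_le\<close> requires.\<close>

fun update :: "nat \<Rightarrow> point set \<Rightarrow> state \<Rightarrow> point \<Rightarrow> state" where
  "update N K (q, b, L) g = (let h = feedback N K (q, b, L) g in
     (q + (enorm N g)\<^sup>2,
      \<lambda>k. ball_proj N (b k - (\<lambda>i. (1 / (sqrt q / 2 ^ k)) * h i)),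
      \<lambda>k. L k + dot N h (b k)))"

definition run :: "nat \<Rightarrow> point set \<Rightarrow> point list \<Rightarrow> state" where
  "run N K = foldl (update N K) (0, \<lambda>_ _. 0, \<lambda>_. 0)"

definition learner :: online_alg where
  "learner N K gs = nearest N K (unprojected N K (run N K gs))"

text \<open>Rounds count from 1, states from 0: state \<open>n\<close> has absorbed the gradients of
  rounds 1 to \<open>n\<close> and determines the decision of round \<open>Suc n\<close>.\<close>

abbreviation state_at :: "nat \<Rightarrow> point set \<Rightarrow> (nat \<Rightarrow> point) \<Rightarrow> nat \<Rightarrow> state" where
  "state_at N K g n \<equiv> run N K (map g [1..<Suc n])"

lemma state_at_0: "state_at N K g 0 = (0, \<lambda>_ _. 0, \<lambda>_. 0)"
  by (simp add: run_def)

lemma state_at_Suc: "state_at N K g (Suc n) = update N K (state_at N K g n) (g (Suc n))"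
  by (simp add: run_def)

lemma fst_update: "fst (update N K S g) = fst S + (enorm N g)\<^sup>2"
  by (cases S) (simp add: Let_def)

lemma fst_state_at: "fst (state_at N K g n) = (\<Sum>s<n. (enorm N (g (Suc s)))\<^sup>2)"
proof (induction n)
  case 0
  show ?case unfolding state_at_0 by simp
next
  case (Suc n)
  then show ?case unfolding state_at_Suc fst_update by simp
qed

lemma universal_learner_run:
  fixes N :: nat and K :: "point set" and g :: "nat \<Rightarrow> point"
  defines "S \<equiv> state_at N K g"
  shows "universal_learner N (\<lambda>n. feedback N K (S n) (g (Suc n))) (\<lambda>n. fst (S n))
    (\<lambda>k n. fst (snd (S n)) k)
    (\<lambda>k n. clip01 (- snd (snd (S n)) k / (2 ^ k * sqrt (fst (S n)))))"
proof
  have S0: "S 0 = (0, \<lambda>_ _. 0, \<lambda>_. 0)" unfolding S_def by (rule state_at_0)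
  have S_Suc: "S (Suc n) = update N K (S n) (g (Suc n))" for n unfolding S_def by (rule state_at_Suc)
  have pos: "0 \<le> fst (S n)" for n unfolding S_def fst_state_at by (simp add: sum_nonneg)
  show "(enorm N (feedback N K (S n) (g (Suc n))))\<^sup>2 \<le> fst (S n)" for n
  proof -
    have "enorm N (feedback N K (S n) (g (Suc n))) \<le> sqrt (fst (S n))"
      unfolding feedback_def
      by (rule order_trans[OF enorm_surrogate_le enorm_clip_norm_le(1)]) (simp add: pos)
    from power_mono[OF this enorm_nonneg, of 2] show ?thesis using pos by simp
  qed
  show "(enorm N (feedback N K (S n) (g (Suc n))))\<^sup>2 \<le> fst (S (Suc n)) - fst (S n)" for n
    unfolding S_Suc fst_update feedback_def
    using power_mono[OF order_trans[OF enorm_surrogate_le enorm_clip_norm_le(2)] enorm_nonneg, of "sqrt (fst (S n))" N K _ "g (Suc n)" 2] pos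
    by simp
  show "fst (snd (S 0)) k = (\<lambda>_. 0)" for k
    by (simp add: S0)
  show "fst (snd (S (Suc n))) k = ball_proj N (fst (snd (S n)) k
      - (\<lambda>i. 1 / (sqrt (fst (S n)) / 2 ^ k) * feedback N K (S n) (g (Suc n)) i))" for k n
    unfolding S_Suc by (cases "S n") (simp add: Let_def)
  \<comment> \<open>The third component accumulates exactly the losses summed in
    \<open>w_eq\<close>.\<close>
  have "snd (snd (S n)) k = (\<Sum>s<n. dot N (feedback N K (S s) (g (Suc s))) (fst (snd (S s)) k))" for n k
  proof (induction n)
    case (Suc n)
    then show ?case unfolding S_Suc by (cases "S n") (simp add: Let_def)
  qed (simp add: S0)
  then show "clip01 (- snd (snd (S n)) k / (2 ^ k * sqrt (fst (S n))))
      = clip01 (- (\<Sum>s<n. dot N (feedback N K (S s) (g (Suc s))) (fst (snd (S s)) k)) / (2 ^ k * sqrt (fst (S n))))" for n k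
    by simp
qed

section \<open>Guarantees for the learner\<close>

lemma feasible_learner: "decision_set N K \<Longrightarrow> feasible_alg learner N K"
  by (simp add: feasible_alg_def learner_def nearest_in)

text \<open>The constant is \<open>27 + 1\<close>: each of the three parts of the comparator costs
  9, and clipping costs 1.\<close>

lemma linear_regret:
  fixes g u :: "nat \<Rightarrow> point" and Ds P :: real
  assumes K: "decision_set N K"
    and T: "1 \<le> T"
    and u: "\<And>n. n < T \<Longrightarrow> u n \<in> K"
    and Ds: "\<And>n. n < T \<Longrightarrow> enorm N (u n - u 0) \<le> Ds" "Ds \<le> diam N K"
    and P: "(\<Sum>n<T-1. enorm N (u (Suc n) - u n)) = P"
  shows "(\<Sum>n<T. dot N (g (Suc n)) (decision learner N K g (Suc n) - u n))
    \<le> 28 * sqrt ((Ds * P + (diam N K)\<^sup>2) * (\<Sum>n<T. (enorm N (g (Suc n)))\<^sup>2))"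
proof -
  define S where "S = state_at N K g"
  define Q where "Q n = fst (S n)" for n
  define p where "p n = unprojected N K (S n)" for n
  define x where "x n = nearest N K (p n)" for n
  define gc where "gc n = clip_norm N (sqrt (Q n)) (g (Suc n))" for n
  define h where "h n = feedback N K (S n) (g (Suc n))" for n
  define D where "D = diam N K"
  define c where "c = (SOME x. x \<in> K)"
  interpret universal_learner N h Q "\<lambda>k n. fst (snd (S n)) k"
    "\<lambda>k n. clip01 (- snd (snd (S n)) k / (2 ^ k * sqrt (fst (S n))))"
    unfolding h_def[abs_def] Q_def[abs_def] S_def by (rule universal_learner_run[where N = N and K = K and g = g])
  have c: "c \<in> K"
    unfolding c_def some_in_eq using u[of 0] T by auto
  have D: "0 < D" using K by (simp add: decision_set_def D_def)
  have Ds0: "0 \<le> Ds" using Ds(1)[of 0] T enorm_nonneg[of N "u 0 - u 0"] by linarith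
  have P0: "0 \<le> P" unfolding P[symmetric] by (simp add: sum_nonneg enorm_nonneg)
  define R where "R = sqrt (Q T)"
  have R: "0 \<le> R" by (simp add: R_def Q_nonneg)
  have Q_T: "Q n = (\<Sum>s<n. (enorm N (g (Suc s)))\<^sup>2)" for n
    unfolding Q_def S_def by (rule fst_state_at)
  have decision: "decision learner N K g (Suc n) = x n" for n
    unfolding decision_def learner_def x_def p_def S_def ..
  have p: "p n = (\<lambda>i. c i + 2 * D * y n i)" for n
    unfolding p_def y_def c_def D_def by (cases "S n") simp

  \<comment> \<open>Clipping is charged at the decisions \<open>x n\<close>, which lie in
    \<open>K\<close> and so within \<open>D\<close> of the comparators.\<close>
  have clip_part: "(\<Sum>n<T. dot N (g (Suc n) - gc n) (x n - u n)) \<le> D * R"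
  proof -
    have "(\<Sum>n<T. dot N (g (Suc n) - gc n) (x n - u n))
        \<le> (\<Sum>n<T. D * max 0 (enorm N (g (Suc n)) - sqrt (Q n)))"
    proof (rule sum_mono)
      fix n assume "n \<in> {..<T}"
      then have "enorm N (x n - u n) \<le> D"
        unfolding D_def x_def by (intro enorm_diff_le_diam K nearest_in u) auto
      then have "dot N (g (Suc n) - gc n) (x n - u n) \<le> enorm N (g (Suc n) - gc n) * D"
        by (intro order_trans[OF dot_le] mult_left_mono enorm_nonneg)
      then show "dot N (g (Suc n) - gc n) (x n - u n) \<le> D * max 0 (enorm N (g (Suc n)) - sqrt (Q n))"
        by (simp add: gc_def enorm_diff_clip_norm Q_nonneg mult.commute)
    qed
    also have "\<dots> \<le> D * R"
      unfolding sum_distrib_left[symmetric] R_def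
      using D by (intro mult_left_mono sum_clip_excess_le) (auto simp: Q_T intro!: sum_nonneg)
    finally show ?thesis .
  qed

  define v0 where "v0 = (\<lambda>i. 1 / D * (u 0 - c) i)"
  \<comment> \<open>\<open>dynamic_regret\<close> takes comparators up to index \<open>T\<close>;
    freezing them at \<open>T - 1\<close> adds no path length. For \<open>Ds = 0\<close> division
    gives \<open>v n = 0\<close>, consistent with \<open>u n\<close> being at distance 0 from
    \<open>u 0\<close>.\<close>
  define v where "v n = (\<lambda>i. 1 / Ds * (u (min n (T - 1)) - u 0) i)" for n
  have v0: "enorm N v0 \<le> 1"
    using enorm_diff_le_diam[OF K u[of 0] c] T D unfolding v0_def enorm_scale by (simp add: D_def del: minus_apply)
  have v: "enorm N (v n) \<le> 1" for n
    using Ds(1)[of "min n (T - 1)"] T Ds0 unfolding v_def enorm_scale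
    by (cases "Ds = 0") (auto simp: divide_simps simp del: minus_apply)
  define Pv where "Pv = (\<Sum>n<T. enorm N (v (Suc n) - v n))"
  have Pv: "Ds * Pv \<le> P"
  proof -
    have T': "{..<T} = insert (T - 1) {..<T - 1}" using T by auto
    have vv: "v (Suc n) - v n = (\<lambda>i. 1 / Ds * (u (min (Suc n) (T - 1)) - u (min n (T - 1))) i)" for n
      by (auto simp: v_def algebra_simps diff_divide_distrib)
    have "Ds * enorm N (v (Suc n) - v n) \<le> enorm N (u (Suc n) - u n)" if "n < T - 1" for n
      using that Ds0 unfolding vv enorm_scale by (simp add: enorm_nonneg del: minus_apply)
    moreover have "enorm N (v (Suc (T - 1)) - v (T - 1)) = 0"
      unfolding vv enorm_scale by (simp add: enorm_def L2_set_def)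
    ultimately show ?thesis
      unfolding Pv_def T' P[symmetric] by (auto simp: sum_distrib_left intro!: sum_mono)
  qed
  \<comment> \<open>The weights \<open>D\<close>, \<open>Ds\<close> and \<open>D - Ds\<close> total
    \<open>2 * D\<close>, whence the factor of \<open>y n\<close> in
    \<open>unprojected\<close>.\<close>
  have split: "dot N (h n) (p n - u n)
      = D * dot N (h n) (y n - v0) + Ds * dot N (h n) (y n - v n) + (D - Ds) * dot N (h n) (y n - (\<lambda>_. 0))"
    if "n < T" for n
  proof -
    have "p n - u n = (\<lambda>i. 2 * D * y n i) - (u 0 - c) - (u n - u 0)"
      by (auto simp: p)
    then have "dot N (h n) (p n - u n)
        = 2 * D * dot N (h n) (y n) - dot N (h n) (u 0 - c) - dot N (h n) (u n - u 0)"
      by (simp only: dot_diff_right dot_scale_right)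
    moreover have "D * dot N (h n) v0 = dot N (h n) (u 0 - c)"
      unfolding v0_def dot_scale_right using D by (simp del: minus_apply)
    moreover have "Ds * dot N (h n) (v n) = dot N (h n) (u n - u 0)"
    proof (cases "Ds = 0")
      case True
      then have "enorm N (u n - u 0) = 0" using Ds(1)[OF that] enorm_nonneg[of N "u n - u 0"] by simp
      then show ?thesis using True abs_dot_le[of N "h n" "u n - u 0"] by simp
    next
      case False
      have "min n (T - 1) = n" using that by simp
      then show ?thesis unfolding v_def dot_scale_right using False by (simp del: minus_apply)
    qed
    moreover have "dot N (h n) (\<lambda>_. 0) = 0" by (simp add: dot_def)
    ultimately show ?thesis by (simp add: dot_diff_right algebra_simps)
  qed
  have zero: "enorm N (\<lambda>_. 0) = 0" "enorm N (x - x) = 0" for x by (auto simp: enorm_def L2_set_def)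
  have r0: "(\<Sum>n<T. dot N (h n) (y n - v0)) \<le> 9 * R"
    using dynamic_regret[of T "\<lambda>_. v0"] v0 by (simp add: R_def zero del: minus_apply)
  have r1: "(\<Sum>n<T. dot N (h n) (y n - v n)) \<le> 9 * sqrt (1 + Pv) * R"
    using dynamic_regret[of T v] v by (simp add: R_def Pv_def real_sqrt_mult)
  have r2: "(\<Sum>n<T. dot N (h n) (y n - (\<lambda>_. 0))) \<le> 9 * R"
    using dynamic_regret[of T "\<lambda>_ _. 0"] by (simp add: R_def zero fun_diff_def)
  define B where "B = sqrt (Ds * P + D\<^sup>2)"
  have B: "D \<le> B" unfolding B_def using Ds0 P0 by (intro real_le_rsqrt) simp
  \<comment> \<open>Squaring leaves \<open>Ds\<^sup>2 + Ds * (Ds * Pv)\<close>; by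
    \<open>Pv\<close>, the unscaled path length appears multiplied by \<open>Ds\<close> rather than
    \<open>D\<close>.\<close>
  have "Ds * sqrt (1 + Pv) \<le> B"
  proof -
    have "Ds * sqrt (1 + Pv) = sqrt (Ds\<^sup>2 * (1 + Pv))" using Ds0 by (simp add: real_sqrt_mult)
    also have "Ds\<^sup>2 * (1 + Pv) \<le> Ds * P + D\<^sup>2"
      using mult_left_mono[OF Pv Ds0] power_mono[OF Ds(2) Ds0, of 2]
      by (simp add: D_def power2_eq_square algebra_simps)
    finally show ?thesis by (simp add: B_def)
  qed
  from mult_right_mono[OF this R] have move: "Ds * (9 * sqrt (1 + Pv) * R) \<le> 9 * (B * R)"
    by (simp add: mult_ac)
  have stay: "D * (9 * R) \<le> 9 * (B * R)" "(D - Ds) * (9 * R) \<le> 9 * (B * R)" "D * R \<le> B * R"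
    using mult_right_mono[OF B R] mult_nonneg_nonneg[OF Ds0 R] by (simp_all add: algebra_simps)
  \<comment> \<open>Only here do the projected decisions give way to the points \<open>p n\<close>,
    to which the splitting applies.\<close>
  have "(\<Sum>n<T. dot N (gc n) (x n - u n)) \<le> (\<Sum>n<T. dot N (h n) (p n - u n))"
    unfolding x_def h_def feedback_def gc_def p_def Q_def
    by (intro sum_mono surrogate_regret K u) auto
  also have "\<dots> = D * (\<Sum>n<T. dot N (h n) (y n - v0)) + Ds * (\<Sum>n<T. dot N (h n) (y n - v n))
      + (D - Ds) * (\<Sum>n<T. dot N (h n) (y n - (\<lambda>_. 0)))"
    using split by (simp add: sum.distrib sum_distrib_left del: minus_apply)
  also have "\<dots> \<le> D * (9 * R) + Ds * (9 * sqrt (1 + Pv) * R) + (D - Ds) * (9 * R)"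
    using r0 r1 r2 D Ds0 Ds(2) by (intro add_mono mult_left_mono) (auto simp: D_def)
  also have "\<dots> \<le> 27 * (B * R)"
    using move stay by linarith
  finally have "(\<Sum>n<T. dot N (gc n) (x n - u n)) \<le> 27 * (B * R)" .
  with clip_part stay(3) have "(\<Sum>n<T. dot N (g (Suc n)) (x n - u n)) \<le> 28 * (B * R)"
    by (simp add: dot_diff_left sum_subtractf)
  then show ?thesis
    unfolding decision by (simp add: B_def R_def D_def Q_T real_sqrt_mult)
qed

theorem mainTheorem9:
  shows "\<exists>(C::real) (A::online_alg). \<forall>(N::nat) (K::point set). decision_set N K \<longrightarrow>
    feasible_alg A N K \<and>
    (\<forall>(T::nat) (f::nat \<Rightarrow> point \<Rightarrow> real) (g::nat \<Rightarrow> point).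
      1 \<le> T \<longrightarrow>
      (\<forall>t\<in>{1..T}. convex_fun_on K (f t) \<and> g t \<in> subdiff N K (f t) (decision A N K g t)) \<longrightarrow>
      (\<forall>u::nat \<Rightarrow> point. (\<forall>t\<in>{1..T}. u t \<in> K) \<longrightarrow>
        (\<Sum>t=1..T. f t (decision A N K g t) - f t (u t))
          \<le> C * sqrt ((comparator_diam N T u * path_length N T u + (diam N K)\<^sup>2)
                        * (\<Sum>t=1..T. (enorm N (g t))\<^sup>2))))"
proof (rule exI[of _ 28], rule exI[of _ learner], intro allI impI conjI)
  fix N K assume K: "decision_set N K"
  then show "feasible_alg learner N K" by (rule feasible_learner)
  fix T and f :: "nat \<Rightarrow> point \<Rightarrow> real" and g u :: "nat \<Rightarrow> point"
  assume T: "1 \<le> T"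
    and g: "\<forall>t\<in>{1..T}. convex_fun_on K (f t) \<and> g t \<in> subdiff N K (f t) (decision learner N K g t)"
    and u: "\<forall>t\<in>{1..T}. u t \<in> K"
  \<comment> \<open>The subgradient inequality reduces the claim to linear losses; round
    \<open>t\<close> then becomes \<open>Suc n\<close> with \<open>n < T\<close>.\<close>
  have "(\<Sum>t=1..T. f t (decision learner N K g t) - f t (u t))
      \<le> (\<Sum>t=1..T. dot N (g t) (decision learner N K g t - u t))"
    using g u by (intro sum_mono) (auto simp: subdiff_def)
  also have "\<dots> = (\<Sum>n<T. dot N (g (Suc n)) (decision learner N K g (Suc n) - u (Suc n)))"
    by (simp add: sum.atLeast1_atMost_eq)
  also have "\<dots> \<le> 28 * sqrt ((comparator_diam N T u * path_length N T u + (diam N K)\<^sup>2)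
      * (\<Sum>n<T. (enorm N (g (Suc n)))\<^sup>2))"
  proof (rule linear_regret[OF K T, of "\<lambda>n. u (Suc n)"])
    show "u (Suc n) \<in> K" if "n < T" for n using u that by auto
    show "enorm N (u (Suc n) - u (Suc 0)) \<le> comparator_diam N T u" if "n < T" for n
      unfolding comparator_diam_def using that T
      by (intro Max_ge) (auto intro!: image_eqI[where x = "(Suc n, Suc 0)"])
    show "comparator_diam N T u \<le> diam N K"
      unfolding comparator_diam_def using T u
      by (subst Max_le_iff) (auto intro!: enorm_diff_le_diam K)
    show "(\<Sum>n<T - 1. enorm N (u (Suc (Suc n)) - u (Suc n))) = path_length N T u"
      by (simp add: path_length_def sum.atLeast1_atMost_eq)
  qed
  finally show "(\<Sum>t=1..T. f t (decision learner N K g t) - f t (u t))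
      \<le> 28 * sqrt ((comparator_diam N T u * path_length N T u + (diam N K)\<^sup>2)
        * (\<Sum>t=1..T. (enorm N (g t))\<^sup>2))"
    by (simp add: sum.atLeast1_atMost_eq)
qed

end
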